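(* Let $G=(V,E)$ be any unweighted undirected multi-graph with $n$ vertices and let $\beta\in(0,1)$. Let $W$ be any collection of $\beta$-shorted walks on $G$ (with terminal set $T$). Then, with high probability, every random walk in $W$ that starts in a connected component of $G$ containing a vertex of $T$ terminates at a vertex of $T$.
   Context: A collection of $\beta$-shorted walks $W$ on $G$ is a set of random walks created as follows: (1) choose a set of terminals $T$ by including the endpoints of each edge independently with probability at least $\beta$; (2) for each edge $e\in E$, generate $\rho=O(\log n\,\epsilon^{-2})$ random walks from its endpoints, each walk continued until either $\Omega(\beta^{-1}\log n)$ distinct edges have been hit, or it reaches $T$, or it has visited every edge in the connected component of $e$. A random walk moves at each step to a uniformly random neighbor (counting edge multiplicities). "With high probability" means with probability at least $1-n^{-c}$ for a constant $c>0$.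
   Formalization: The formal theorem assumes, for an arbitrary fixed exponent a on which the hidden constant in Ω(β^{-1} log n) may depend, that 1/ε ≤ n^a and that either the number of edges or 1/β is at most n^a; without such bounds the claim fails. *)

theory Defs
  imports "HOL-Probability.Probability"
begin

text \<open>
  Undirected multigraphs: edges are names, so parallel edges are distinct edges with the same
  end set. A self-loop is an edge with a singleton end set.
\<close>

record ('v, 'e) mgraph =
  verts :: "'v set"
  edges :: "'e set"
  ends :: "'e \<Rightarrow> 'v set"

definition multigraph :: "('v, 'e) mgraph \<Rightarrow> bool" where
  "multigraph G \<longleftrightarrow> finite (verts G) \<and> finite (edges G) \<and>
     (\<forall>e\<in>edges G. ends G e \<subseteq> verts G \<and> card (ends G e) \<in> {1, 2})"

definition incident :: "('v, 'e) mgraph \<Rightarrow> 'v \<Rightarrow> 'e set" where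
  "incident G v = {e \<in> edges G. v \<in> ends G e}"

text \<open>The end of \<open>e\<close> other than \<open>v\<close>, and \<open>v\<close> itself if \<open>e\<close> is a loop at \<open>v\<close>.\<close>

definition opposite :: "('v, 'e) mgraph \<Rightarrow> 'e \<Rightarrow> 'v \<Rightarrow> 'v" where
  "opposite G e v = (THE u. ends G e = {v, u})"

definition adjacent :: "('v, 'e) mgraph \<Rightarrow> 'v \<Rightarrow> 'v \<Rightarrow> bool" where
  "adjacent G u v \<longleftrightarrow> (\<exists>e\<in>edges G. ends G e = {u, v})"

definition component :: "('v, 'e) mgraph \<Rightarrow> 'v \<Rightarrow> 'v set" where
  "component G v = {u. (adjacent G)\<^sup>*\<^sup>* v u}"

definition component_edges :: "('v, 'e) mgraph \<Rightarrow> 'v \<Rightarrow> 'e set" where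
  "component_edges G v = {e \<in> edges G. ends G e \<subseteq> component G v}"

text \<open>
  A walk is its start vertex together with the list of its steps, in order; a step records the
  edge traversed and the vertex it leads to.
\<close>

type_synonym ('v, 'e) walk = "'v \<times> ('e \<times> 'v) list"

definition walk_start :: "('v, 'e) walk \<Rightarrow> 'v" where
  "walk_start w = fst w"

definition walk_end :: "('v, 'e) walk \<Rightarrow> 'v" where
  "walk_end w = last (fst w # map snd (snd w))"

definition walk_edges :: "('v, 'e) walk \<Rightarrow> 'e set" where
  "walk_edges w = set (map fst (snd w))"

definition walk_step :: "('v, 'e) mgraph \<Rightarrow> ('v, 'e) walk \<Rightarrow> 'e \<Rightarrow> ('v, 'e) walk" where
  "walk_step G w e = (fst w, snd w @ [(e, opposite G e (walk_end w))])"

definition stopped :: "('v, 'e) mgraph \<Rightarrow> 'v set \<Rightarrow> real \<Rightarrow> ('v, 'e) walk \<Rightarrow> bool" where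
  "stopped G T l w \<longleftrightarrow>
     real (card (walk_edges w)) \<ge> l \<or>
     walk_end w \<in> T \<or>
     component_edges G (walk_start w) \<subseteq> walk_edges w"

text \<open>
  Extend a walk by random steps until it is stopped. Choosing a uniformly random incident edge is
  choosing a uniformly random neighbour, counted with edge multiplicity (a loop counts once).
  As a least fixed point in the subprobability mass functions, the missing mass is exactly the
  probability that the walk never stops.
\<close>

partial_function (spmf) run_walk ::
  "('v, 'e) mgraph \<Rightarrow> 'v set \<Rightarrow> real \<Rightarrow> ('v, 'e) walk \<Rightarrow> ('v, 'e) walk spmf" where
  "run_walk G T l w =
     (if stopped G T l w then return_spmf w
      else bind_spmf (spmf_of_set (incident G (walk_end w)))
             (\<lambda>e. run_walk G T l (walk_step G w e)))"

text \<open>The index \<open>(e, v, i)\<close> stands for the \<open>i\<close>-th walk generated for \<open>e\<close> from its end \<open>v\<close>.\<close>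

definition walk_index :: "('v, 'e) mgraph \<Rightarrow> nat \<Rightarrow> ('e \<times> 'v \<times> nat) set" where
  "walk_index G \<rho> = {(e, v, i). e \<in> edges G \<and> v \<in> ends G e \<and> i < \<rho>}"

definition terminals :: "('v, 'e) mgraph \<Rightarrow> ('e \<Rightarrow> bool) \<Rightarrow> 'v set" where
  "terminals G S = (\<Union>e\<in>{e \<in> edges G. S e}. ends G e)"

text \<open>
  Joint law of the terminal set and of the collection of walks, where \<open>p e\<close> is the probability
  with which the ends of \<open>e\<close> are included in the terminal set. The walks are independent given
  the terminal set; the value \<open>None\<close> at an index in \<open>walk_index G \<rho>\<close> is a walk that never stops.
\<close>

definition shorted_walks ::
  "('v, 'e) mgraph \<Rightarrow> ('e \<Rightarrow> real) \<Rightarrow> real \<Rightarrow> nat \<Rightarrow>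
     ('v set \<times> ('e \<times> 'v \<times> nat \<Rightarrow> ('v, 'e) walk option)) pmf" where
  "shorted_walks G p l \<rho> =
     bind_pmf (Pi_pmf (edges G) False (\<lambda>e. bernoulli_pmf (p e))) (\<lambda>S.
     bind_pmf (Pi_pmf (walk_index G \<rho>) None
                 (\<lambda>(e, v, i). run_walk G (terminals G S) l (v, []))) (\<lambda>W.
     return_pmf (terminals G S, W)))"

text \<open>
  The laws of collections of \<open>\<beta>\<close>-shorted walks, with \<open>C\<close> the constant hidden in
  \<open>\<Omega>(\<beta>\<^sup>-\<^sup>1 log n)\<close> and \<open>K\<close> the constant hidden in \<open>\<rho> = O(log n \<epsilon>\<^sup>-\<^sup>2)\<close>.
\<close>

definition beta_shorted ::
  "real \<Rightarrow> real \<Rightarrow> real \<Rightarrow> real \<Rightarrow> ('v, 'e) mgraph \<Rightarrow> nat \<Rightarrow>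
     ('v set \<times> ('e \<times> 'v \<times> nat \<Rightarrow> ('v, 'e) walk option)) pmf \<Rightarrow> bool" where
  "beta_shorted C K \<beta> \<epsilon> G \<rho> D \<longleftrightarrow>
     real \<rho> \<le> K * ln (real (card (verts G))) / \<epsilon>\<^sup>2 \<and>
     (\<exists>p l. (\<forall>e\<in>edges G. \<beta> \<le> p e \<and> p e \<le> 1) \<and>
        C * ln (real (card (verts G))) / \<beta> \<le> l \<and>
        D = shorted_walks G p l \<rho>)"

end

theory Submission
  imports Defs
begin

text \<open>
  If a walk from \<open>v\<close> stops outside the terminals, then no edge on it and no edge at \<open>v\<close> was selected;
  if moreover its component contains a terminal, it cannot have covered the component, so it has
  visited at least \<open>l\<close> distinct edges. Comparing with the walk run without terminals, which is
  independent of the selection, bounds the probability of this by \<open>(1 - \<beta>)\<close> to the power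
  \<open>max l (deg v) \<ge> (l + deg v) / 2\<close>. Almost surely the walk stops, since a finite component gets
  covered.

  In the union bound each vertex \<open>v\<close> starts \<open>\<rho> * deg v\<close> walks. The gain \<open>exp (- \<beta> * deg v / 2)\<close> turns
  the factor \<open>deg v\<close> into at most \<open>2 / \<beta>\<close>, so that either a polynomial bound on the number of edges
  or one on \<open>1 / \<beta>\<close> suffices.
\<close>

section \<open>Fixpoint arguments for the walk process\<close>

text \<open>Transfers step invariants to finished runs. Fixpoint induction applies to a bound on the
  support, which is empty for the diverging run.\<close>

lemma run_walk_set_induct:
  assumes "x \<in> set_spmf (run_walk G T l w)" "I w"
    and step: "\<And>w e. I w \<Longrightarrow> \<not> stopped G T l w \<Longrightarrow> e \<in> set_spmf (spmf_of_set (incident G (walk_end w)))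
      \<Longrightarrow> I (walk_step G w e)"
  shows "I x \<and> stopped G T l x"
proof -
  have "\<forall>w. I w \<longrightarrow> set_spmf (run_walk G T l w) \<subseteq> {x. I x \<and> stopped G T l x}"
  proof (induction rule: run_walk.fixp_induct[where P="\<lambda>r. \<forall>w. I w \<longrightarrow> set_spmf (r G T l w) \<subseteq> {x. I x \<and> stopped G T l x}"])
    case 1
    then show ?case by simp
  next
    case 2
    then show ?case by simp
  next
    case (3 r)
    show ?case
    proof (intro allI impI)
      fix w assume "I w"
      then show "set_spmf (if stopped G T l w then return_spmf w
          else spmf_of_set (incident G (walk_end w)) \<bind> (\<lambda>e. r G T l (walk_step G w e)))
        \<subseteq> {x. I x \<and> stopped G T l x}"
        using 3[rule_format, OF step[of w]]
        by (cases "stopped G T l w") (simp_all add: set_bind_spmf bind_UNION UN_subset_iff)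
    qed
  qed
  with assms show ?thesis by blast
qed

text \<open>A run ending at \<open>x\<close> outside \<open>T'\<close> was never halted by reaching
  \<open>T'\<close>, so the same steps lead to \<open>x\<close> under \<open>T\<close>. Where the
  \<open>T'\<close> run halts strictly earlier, it does so inside \<open>T'\<close> and puts no mass
  on \<open>x\<close>.\<close>

lemma spmf_run_walk_mono:
  assumes "T \<subseteq> T'" "walk_end x \<notin> T'"
  shows "spmf (run_walk G T' l w) x \<le> spmf (run_walk G T l w) x"
proof -
  have st: "stopped G T l w \<Longrightarrow> stopped G T' l w" for w
    using assms(1) by (auto simp: stopped_def)
  \<comment> \<open>Only the left-hand run is approximated; the right-hand one unfolds by its
    recursion equation. In \<open>ennreal\<close> both binds become nonnegative integrals, compared
    pointwise.\<close>
  have "\<forall>w. ennreal (spmf (run_walk G T' l w) x) \<le> ennreal (spmf (run_walk G T l w) x)"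
  proof (induction rule: run_walk.fixp_induct[where P="\<lambda>r. \<forall>w. ennreal (spmf (r G T' l w) x) \<le> ennreal (spmf (run_walk G T l w) x)"])
    case 1
    then show ?case by (simp del: ennreal_le_iff split_paired_All)
  next
    case 2
    then show ?case by simp
  next
    case (3 r)
    show ?case
    proof
      fix w
      consider "stopped G T l w" "stopped G T' l w" | "\<not> stopped G T l w" "stopped G T' l w"
        | "\<not> stopped G T l w" "\<not> stopped G T' l w"
        using st by blast
      then show "ennreal (spmf (if stopped G T' l w then return_spmf w
          else spmf_of_set (incident G (walk_end w)) \<bind> (\<lambda>e. r G T' l (walk_step G w e))) x)
        \<le> ennreal (spmf (run_walk G T l w) x)"
      proof cases
        case 2
        have "w \<noteq> x" using 2 assms(2) by (auto simp: stopped_def)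
        then show ?thesis using 2 by simp
      next
        case case_3: 3
        then show ?thesis using 3
          by (subst run_walk.simps)
             (auto simp: ennreal_spmf_bind simp del: ennreal_le_iff split_paired_All intro!: nn_integral_mono)
      qed (simp add: run_walk.simps)
    qed
  qed
  then show ?thesis by (simp del: split_paired_All)
qed

section \<open>Walks inside a connected component\<close>

definition visited :: "('v, 'e) walk \<Rightarrow> 'v set" where
  "visited w = insert (fst w) (snd ` set (snd w))"

text \<open>Invariant of the runs from \<open>v\<close>. Its last conjunct later turns the absence
  of visited terminals into the absence of selected edges along the walk.\<close>

definition walk_within :: "('v, 'e) mgraph \<Rightarrow> 'v \<Rightarrow> ('v, 'e) walk \<Rightarrow> bool" where
  "walk_within G v w \<longleftrightarrow> walk_start w = v \<and> walk_end w \<in> component G v \<and>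
     walk_edges w \<subseteq> component_edges G v \<and> (\<forall>e\<in>walk_edges w. ends G e \<subseteq> visited w)"

lemma walk_start_step [simp]: "walk_start (walk_step G w e) = walk_start w"
  and walk_end_step [simp]: "walk_end (walk_step G w e) = opposite G e (walk_end w)"
  and walk_edges_step [simp]: "walk_edges (walk_step G w e) = insert e (walk_edges w)"
  and visited_step [simp]:
    "visited (walk_step G w e) = insert (opposite G e (walk_end w)) (visited w)"
  by (auto simp: walk_start_def walk_end_def walk_edges_def visited_def walk_step_def)

lemma walk_end_visited: "walk_end w \<in> visited w"
proof (cases "snd w = []")
  case False
  then have "last (snd w) \<in> set (snd w)" by simp
  then show ?thesis using False by (auto simp: walk_end_def visited_def last_map)
qed (simp add: walk_end_def visited_def)

lemma ends_opposite:
  assumes "multigraph G" "e \<in> incident G v"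
  shows "ends G e = {v, opposite G e v}"
proof -
  have e: "card (ends G e) \<in> {1, 2}" "v \<in> ends G e"
    using assms by (auto simp: multigraph_def incident_def)
  have "\<exists>u. ends G e = {v, u}"
  proof (cases "card (ends G e) = 1")
    case True
    then show ?thesis using e(2) by (auto simp: card_1_singleton_iff)
  next
    case False
    then show ?thesis using e by (auto simp: card_2_iff)
  qed
  then have "\<exists>!u. ends G e = {v, u}" by (auto simp: doubleton_eq_iff)
  then show ?thesis unfolding opposite_def by (rule theI')
qed

lemma opposite_eqI:
  assumes "ends G e = {v, u}"
  shows "opposite G e v = u"
  unfolding opposite_def using assms by (auto simp: doubleton_eq_iff)

lemma component_step:
  assumes "u \<in> component G v" "e \<in> edges G" "ends G e = {u, y}"
  shows "y \<in> component G v" "e \<in> component_edges G v"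
proof -
  have "adjacent G u y" using assms by (auto simp: adjacent_def)
  then show "y \<in> component G v"
    using assms(1) by (auto simp: component_def)
  then show "e \<in> component_edges G v"
    using assms by (auto simp: component_edges_def)
qed

lemma walk_within_step:
  assumes "multigraph G" "walk_within G v w" "e \<in> incident G (walk_end w)"
  shows "walk_within G v (walk_step G w e)"
  using assms ends_opposite[OF assms(1,3)] component_step[of "walk_end w" G v e] walk_end_visited[of w]
  by (auto simp: walk_within_def incident_def)

lemma walk_within_start: "walk_within G v (v, [])"
  by (auto simp: walk_within_def walk_start_def walk_end_def walk_edges_def component_def)

lemma symp_adjacent: "symp (adjacent G)"
  by (auto simp: symp_def adjacent_def insert_commute)

lemma component_connected:
  assumes "u \<in> component G v" "x \<in> component G v"
  shows "(adjacent G)\<^sup>*\<^sup>* u x"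
proof -
  have "(adjacent G)\<^sup>*\<^sup>* u v"
    using assms(1) symp_rtranclp[OF symp_adjacent[of G]] by (auto simp: component_def symp_def)
  with assms(2) show ?thesis by (auto simp: component_def)
qed

lemma component_subset_verts:
  assumes "multigraph G" "v \<in> verts G"
  shows "component G v \<subseteq> verts G"
proof
  fix u assume "u \<in> component G v"
  then have "(adjacent G)\<^sup>*\<^sup>* v u" by (simp add: component_def)
  then show "u \<in> verts G"
    using assms by induction (auto simp: adjacent_def multigraph_def)
qed

lemma finite_component_edges: "multigraph G \<Longrightarrow> finite (component_edges G v)"
  by (auto simp: multigraph_def component_edges_def)

lemma finite_incident: "multigraph G \<Longrightarrow> finite (incident G v)"
  by (auto simp: multigraph_def incident_def)

section \<open>Almost sure stopping\<close>

text \<open>Meant for the loss averaged over the next edge, one choice \<open>a\<close> being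
  favourable. Since \<open>t \<le> s\<close>, replacing the number of choices by the larger
  \<open>m\<close> only weakens the gain.\<close>

lemma average_le:
  fixes g :: "'a \<Rightarrow> real"
  assumes "finite A" "a \<in> A" "\<And>x. x \<in> A \<Longrightarrow> g x \<le> s" "g a \<le> t" "t \<le> s" "card A \<le> m"
  shows "sum g A / card A \<le> s - (s - t) / m"
proof -
  have pos: "0 < card A" using assms by (auto simp: card_gt_0_iff)
  have "sum g A = g a + sum g (A - {a})" using assms by (simp add: sum.remove)
  also have "\<dots> \<le> t + real (card (A - {a})) * s"
    using assms by (intro add_mono sum_bounded_above) auto
  also have "\<dots> = card A * s - (s - t)"
    using assms pos by (simp add: of_nat_diff algebra_simps)
  finally have "sum g A / card A \<le> (card A * s - (s - t)) / card A"
    using pos by (simp add: divide_right_mono)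
  also have "\<dots> = s - (s - t) / card A" using pos by (simp add: field_simps)
  also have "\<dots> \<le> s - (s - t) / m"
    using assms pos by (simp add: frac_le)
  finally show ?thesis .
qed

lemma pmf_run_walk_None:
  assumes "\<not> stopped G T l w" "finite (incident G (walk_end w))" "incident G (walk_end w) \<noteq> {}"
  shows "pmf (run_walk G T l w) None =
    (\<Sum>e\<in>incident G (walk_end w). pmf (run_walk G T l (walk_step G w e)) None) /
      card (incident G (walk_end w))"
  using assms
proof -
  have "pmf (spmf_of_set (incident G (walk_end w))) None = 0"
    using assms by (simp add: lossless_iff_pmf_None[symmetric])
  then show ?thesis
    using assms by (subst run_walk.simps) (simp add: pmf_bind_spmf_None integral_spmf_of_set)
qed

text \<open>
  Along a path of length \<open>j\<close> to an unvisited edge, the walk follows each step with probability at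
  least \<open>q\<close> and then visits a new edge. Walks with fewer than \<open>k\<close> unvisited edges lose no mass, so
  any uniform bound \<open>s\<close> on the loss improves by a constant factor.
\<close>

lemma run_walk_loss_decay:
  fixes G :: "('v, 'e) mgraph"
  defines "q \<equiv> 1 / real (card (edges G))"
  assumes G: "multigraph G"
    and zero: "\<And>w. walk_within G v w \<Longrightarrow> card (component_edges G v - walk_edges w) < k \<Longrightarrow>
      pmf (run_walk G T l w) None = 0"
    and le: "\<And>w. walk_within G v w \<Longrightarrow> card (component_edges G v - walk_edges w) \<le> k \<Longrightarrow>
      pmf (run_walk G T l w) None \<le> s"
    and "walk_within G v w" "card (component_edges G v - walk_edges w) \<le> k"
    and e: "e \<in> component_edges G v - walk_edges w" "x \<in> ends G e"
    and "(adjacent G ^^ j) (walk_end w) x"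
  shows "pmf (run_walk G T l w) None \<le> (1 - q ^ Suc j) * s"
  using assms(5,6,9) e(1)
proof (induction j arbitrary: w)
  have eE: "e \<in> edges G" using e by (auto simp: component_edges_def)
  have m: "card (edges G) > 0" using eE G by (auto simp: card_gt_0_iff multigraph_def)
  have q: "0 < q" "q \<le> 1" using m by (auto simp: q_def)
  have fewer: "card (component_edges G v - walk_edges (walk_step G w e')) \<le> card (component_edges G v - walk_edges w)"
    for w e' using G by (intro card_mono) (auto simp: finite_component_edges)
  have less: "pmf (run_walk G T l (walk_step G w e)) None = 0"
    if "walk_within G v w" "card (component_edges G v - walk_edges w) \<le> k"
      "e \<in> component_edges G v - walk_edges w" "e \<in> incident G (walk_end w)" for w
  proof (rule zero)
    have "component_edges G v - walk_edges (walk_step G w e) \<subset> component_edges G v - walk_edges w"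
      using that by auto
    then have "card (component_edges G v - walk_edges (walk_step G w e)) < card (component_edges G v - walk_edges w)"
      using G by (intro psubset_card_mono) (auto simp: finite_component_edges)
    then show "card (component_edges G v - walk_edges (walk_step G w e)) < k" using that by simp
    show "walk_within G v (walk_step G w e)" using that G by (auto intro: walk_within_step)
  qed
  \<comment> \<open>One step of the path: \<open>e'\<close> is chosen with probability at least
    \<open>q\<close>, as degrees are at most \<open>card (edges G)\<close>, so a gain of
    \<open>q ^ i * s\<close> after \<open>e'\<close> leaves a gain of \<open>q ^ Suc i * s\<close>
    before it.\<close>
  have main: "pmf (run_walk G T l w) None \<le> (1 - q ^ Suc i) * s"
    if w: "walk_within G v w" "card (component_edges G v - walk_edges w) \<le> k"
      and e': "e' \<in> incident G (walk_end w)"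
      "pmf (run_walk G T l (walk_step G w e')) None \<le> (1 - q ^ i) * s" for w e' i
  proof -
    have s: "0 \<le> s" by (rule order_trans[OF pmf_nonneg le[OF w]])
    show ?thesis
    proof (cases "stopped G T l w")
      case True
      have "0 \<le> (1 - q ^ Suc i) * s"
        using s q by (intro mult_nonneg_nonneg) (auto simp: power_le_one simp del: power_Suc)
      then show ?thesis using True by (simp add: run_walk.simps)
    next
      case False
      have "pmf (run_walk G T l w) None =
        (\<Sum>e\<in>incident G (walk_end w). pmf (run_walk G T l (walk_step G w e)) None) /
        card (incident G (walk_end w))"
        using False e' G by (intro pmf_run_walk_None) (auto simp: finite_incident)
      also have "\<dots> \<le> s - (s - (1 - q ^ i) * s) / card (edges G)"
      proof (rule average_le)
        show "pmf (run_walk G T l (walk_step G w d)) None \<le> s" if "d \<in> incident G (walk_end w)" for d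
          using that w G fewer[of w d] by (intro le walk_within_step) auto
        show "(1 - q ^ i) * s \<le> s" using s q by (simp add: mult_left_le_one_le power_le_one)
        show "card (incident G (walk_end w)) \<le> card (edges G)"
          using G by (intro card_mono) (auto simp: incident_def multigraph_def)
      qed (use e' G in \<open>auto simp: finite_incident\<close>)
      also have "\<dots> = (1 - q ^ Suc i) * s"
      proof -
        have "a / card (edges G) = q * a" for a by (simp add: q_def)
        then show ?thesis by (simp add: algebra_simps)
      qed
      finally show ?thesis .
    qed
  qed
  {
    case 0
    then have "e \<in> incident G (walk_end w)" using e eE by (auto simp: incident_def)
    \<comment> \<open>With \<open>i = 0\<close> the loss allowed after the step is
      \<open>(1 - q ^ 0) * s = 0\<close>, which is what traversing the new edge \<open>e\<close>
      guarantees.\<close>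
    then show ?case using main[of w e 0] less[of w] 0 by simp
  next
    case (Suc j)
    obtain y where y: "adjacent G (walk_end w) y" "(adjacent G ^^ j) y x"
      using Suc.prems(3) by (meson relpowp_Suc_E2)
    then obtain e' where e': "e' \<in> edges G" "ends G e' = {walk_end w, y}" by (auto simp: adjacent_def)
    then have inc: "e' \<in> incident G (walk_end w)" by (auto simp: incident_def)
    have "pmf (run_walk G T l (walk_step G w e')) None \<le> (1 - q ^ Suc j) * s"
    proof (cases "e = e'")
      \<comment> \<open>The path may use \<open>e\<close> itself before reaching \<open>x\<close>.
        The induction hypothesis, which wants \<open>e\<close> unvisited, then fails to apply, but
        the loss is already 0.\<close>
      case True
      have "0 \<le> (1 - q ^ Suc j) * s"
        using order_trans[OF pmf_nonneg le[OF Suc.prems(1,2)]] q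
        by (intro mult_nonneg_nonneg) (auto simp: power_le_one simp del: power_Suc)
      then show ?thesis using less[OF Suc.prems(1,2,4)] inc True by auto
    next
      case False
      show ?thesis
      proof (rule Suc.IH)
        show "walk_within G v (walk_step G w e')" using Suc.prems G inc by (auto intro: walk_within_step)
        show "card (component_edges G v - walk_edges (walk_step G w e')) \<le> k"
          using fewer[of w e'] Suc.prems by linarith
        show "(adjacent G ^^ j) (walk_end (walk_step G w e')) x"
          using y e' by (simp add: opposite_eqI)
        show "e \<in> component_edges G v - walk_edges (walk_step G w e')" using Suc.prems False by auto
      qed
    qed
    then show ?case using main[OF Suc.prems(1,2) inc] by blast
  }
qed

text \<open>A uniform path length makes the decay factor the same from every position of the walk.
  The sum of one chosen length per pair serves as a crude bound on each of them.\<close>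

lemma component_diameter_bounded:
  assumes "multigraph G" "v \<in> verts G"
  obtains N where "\<And>u x. u \<in> component G v \<Longrightarrow> x \<in> component G v \<Longrightarrow> \<exists>j\<le>N. (adjacent G ^^ j) u x"
proof -
  let ?P = "component G v \<times> component G v"
  have fin: "finite ?P"
    using component_subset_verts[OF assms] assms(1) by (auto simp: multigraph_def intro: finite_subset)
  have "\<forall>p\<in>?P. \<exists>j. (adjacent G ^^ j) (fst p) (snd p)"
    using component_connected by (auto simp: rtranclp_power)
  then obtain d where d: "\<forall>p\<in>?P. (adjacent G ^^ d p) (fst p) (snd p)" by metis
  show ?thesis
  proof (rule that)
    fix u x assume *: "u \<in> component G v" "x \<in> component G v"
    then show "\<exists>j\<le>(\<Sum>p\<in>?P. d p). (adjacent G ^^ j) u x"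
      using d fin by (intro exI[of _ "d (u, x)"]) (auto intro!: member_le_sum)
  qed
qed

text \<open>Induction on the number of unvisited component edges. At each level the loss is below
  every power of a fixed factor less than 1, hence 0.\<close>

lemma run_walk_lossless:
  assumes G: "multigraph G" and v: "v \<in> verts G" and "walk_within G v w"
  shows "pmf (run_walk G T l w) None = 0"
  using assms(3)
proof (induction "card (component_edges G v - walk_edges w)" arbitrary: w rule: less_induct)
  case less
  define k where "k = card (component_edges G v - walk_edges w)"
  obtain N where N: "\<And>u x. u \<in> component G v \<Longrightarrow> x \<in> component G v \<Longrightarrow> \<exists>j\<le>N. (adjacent G ^^ j) u x"
    using component_diameter_bounded[OF G v] by blast
  define q where "q = 1 / real (card (edges G))"
  have q: "0 \<le> q" "q \<le> 1" by (auto simp: q_def divide_le_eq)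
  \<comment> \<open>The inner induction starts from the trivial bound 1. It ranges over all walks
    with at most \<open>k\<close> unvisited edges, since the walk may move before it meets a new
    edge; those with fewer than \<open>k\<close> fall under the outer hypothesis.\<close>
  have bound: "pmf (run_walk G T l w) None \<le> (1 - q ^ Suc N) ^ i"
    if "walk_within G v w" "card (component_edges G v - walk_edges w) \<le> k" for w i
    using that
  proof (induction i arbitrary: w)
    case 0
    then show ?case by (simp add: pmf_le_1)
  next
    case (Suc i)
    show ?case
    proof (cases "component_edges G v \<subseteq> walk_edges w")
      case True
      then have "stopped G T l w" using Suc.prems by (auto simp: stopped_def walk_within_def)
      moreover have "0 \<le> (1 - q ^ Suc N) ^ Suc i"
        using q by (intro zero_le_power) (auto simp: power_le_one simp del: power_Suc)
      ultimately show ?thesis by (simp add: run_walk.simps)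
    next
      case False
      then obtain e where e: "e \<in> component_edges G v - walk_edges w" by blast
      then have "card (ends G e) \<noteq> 0" "ends G e \<subseteq> component G v"
        using G by (auto simp: component_edges_def multigraph_def)
      then obtain x where x: "x \<in> ends G e" "x \<in> component G v"
        by (cases "ends G e = {}") auto
      obtain j where j: "j \<le> N" "(adjacent G ^^ j) (walk_end w) x"
        using N[of "walk_end w" x] x Suc.prems by (auto simp: walk_within_def)
      have "pmf (run_walk G T l w) None \<le> (1 - q ^ Suc j) * (1 - q ^ Suc N) ^ i"
        unfolding q_def
      proof (rule run_walk_loss_decay[OF G _ _ Suc.prems e x(1) j(2)])
        show "pmf (run_walk G T l w) None = 0"
          if "walk_within G v w" "card (component_edges G v - walk_edges w) < k" for w
          using less.hyps[of w] that by (simp add: k_def)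
        show "pmf (run_walk G T l w) None \<le> (1 - (1 / real (card (edges G))) ^ Suc N) ^ i"
          if "walk_within G v w" "card (component_edges G v - walk_edges w) \<le> k" for w
          using Suc.IH[OF that] by (simp only: q_def)
      qed
      also have "\<dots> \<le> (1 - q ^ Suc N) * (1 - q ^ Suc N) ^ i"
        using q j by (intro mult_right_mono diff_left_mono power_decreasing zero_le_power)
          (auto simp: power_le_one simp del: power_Suc)
      finally show ?thesis by simp
    qed
  qed
  show ?case
  proof (cases "component_edges G v \<subseteq> walk_edges w")
    case True
    then have "stopped G T l w" using less.prems by (auto simp: stopped_def walk_within_def)
    then show ?thesis by (simp add: run_walk.simps)
  next
    case False
    \<comment> \<open>Without edges \<open>q\<close> would be the default \<open>1 / 0 = 0\<close>
      and the factor would be 1; an unvisited edge excludes this.\<close>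
    then have "edges G \<noteq> {}" by (auto simp: component_edges_def)
    then have "0 < q" using G by (auto simp: q_def multigraph_def card_gt_0_iff)
    then have "0 < q ^ Suc N" "q ^ Suc N \<le> 1"
      using q by (auto simp: power_le_one simp del: power_Suc)
    then have "\<bar>1 - q ^ Suc N\<bar> < 1" by linarith
    then have "(\<lambda>i. (1 - q ^ Suc N) ^ i) \<longlonglongrightarrow> 0" by (intro LIMSEQ_power_zero) simp
    then have "pmf (run_walk G T l w) None \<le> 0"
      by (rule LIMSEQ_le_const) (use bound[OF less.prems] in \<open>simp add: k_def del: power_Suc\<close>)
    then show ?thesis by simp
  qed
qed

section \<open>What a miss forces on the selected edges\<close>

lemma run_walk_avoiding_terminals:
  assumes G: "multigraph G"
    and x: "x \<in> set_spmf (run_walk G (terminals G S) l (v, []))"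
    and meets: "component G v \<inter> terminals G S \<noteq> {}"
    and ends: "walk_end x \<notin> terminals G S"
  shows "l \<le> card (walk_edges x)" "walk_edges x \<subseteq> edges G"
    "\<forall>e\<in>walk_edges x \<union> incident G v. \<not> S e"
proof -
  let ?T = "terminals G S"
  \<comment> \<open>A run halts at the first terminal it meets, so only its last vertex can be one;
    with \<open>walk_end x\<close> outside the terminals, none is visited at all.\<close>
  have "(walk_within G v x \<and> visited x \<inter> ?T \<subseteq> {walk_end x}) \<and> stopped G ?T l x"
    using x
  proof (rule run_walk_set_induct)
    show "walk_within G v (v, []) \<and> visited (v, []) \<inter> ?T \<subseteq> {walk_end (v, [])}"
      by (simp add: walk_within_start) (simp add: visited_def walk_end_def)
  next
    fix w e
    assume w: "walk_within G v w \<and> visited w \<inter> ?T \<subseteq> {walk_end w}" "\<not> stopped G ?T l w"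
      "e \<in> set_spmf (spmf_of_set (incident G (walk_end w)))"
    then have "e \<in> incident G (walk_end w)" using G by (simp add: finite_incident)
    moreover have "visited w \<inter> ?T = {}" using w by (auto simp: stopped_def)
    ultimately show "walk_within G v (walk_step G w e) \<and>
        visited (walk_step G w e) \<inter> ?T \<subseteq> {walk_end (walk_step G w e)}"
      using w G by (auto intro: walk_within_step)
  qed
  then have within: "walk_within G v x" and avoid: "visited x \<inter> ?T = {}" and st: "stopped G ?T l x"
    using ends by auto
  show edges: "walk_edges x \<subseteq> edges G"
    using within by (auto simp: walk_within_def component_edges_def)
  have nonempty: "ends G e \<noteq> {}" if "e \<in> edges G" for e
    using that G by (auto simp: multigraph_def)
  have unselected: "\<not> S e" if "e \<in> walk_edges x" for e
    using that nonempty[of e] edges within avoid by (force simp: walk_within_def terminals_def)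
  have "v \<in> visited x" using within by (simp add: walk_within_def walk_start_def visited_def)
  then show "\<forall>e\<in>walk_edges x \<union> incident G v. \<not> S e"
    using avoid unselected by (auto simp: incident_def terminals_def)
  \<comment> \<open>A terminal in the component is an end of a selected edge, which lies in the
    component but not on the walk. Of the three stopping rules only the one on distinct edges
    remains.\<close>
  have "\<not> component_edges G v \<subseteq> walk_edges x"
  proof -
    obtain t e where t: "t \<in> component G v" "e \<in> edges G" "S e" "t \<in> ends G e"
      using meets by (auto simp: terminals_def)
    then have "ends G e = {t, opposite G e t}" using G by (intro ends_opposite) (auto simp: incident_def)
    then have "e \<in> component_edges G v" using t by (auto intro: component_step)
    then show ?thesis using unselected t by blast
  qed
  then show "l \<le> card (walk_edges x)"
    using st ends within by (simp add: stopped_def walk_within_def)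
qed

section \<open>Probability that a single walk misses\<close>

text \<open>Compares two laws that are ordered only on an event, as the runs with and without
  terminals are on the misses.\<close>

lemma emeasure_pmf_le:
  assumes "\<And>x. x \<in> A \<Longrightarrow> x \<in> set_pmf p \<Longrightarrow> x \<in> B \<and> pmf p x \<le> pmf q x"
  shows "emeasure (measure_pmf p) A \<le> emeasure (measure_pmf q) B"
proof -
  have "emeasure (measure_pmf p) A = emeasure (measure_pmf p) (A \<inter> set_pmf p)"
    by (simp add: emeasure_Int_set_pmf)
  also have "\<dots> = (\<integral>\<^sup>+x. pmf p x \<partial>count_space (A \<inter> set_pmf p))"
    by (simp add: nn_integral_pmf)
  also have "\<dots> \<le> (\<integral>\<^sup>+x. pmf q x \<partial>count_space (A \<inter> set_pmf p))"
    using assms by (intro nn_integral_mono) auto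
  also have "\<dots> = emeasure (measure_pmf q) (A \<inter> set_pmf p)"
    by (simp add: nn_integral_pmf)
  also have "\<dots> \<le> emeasure (measure_pmf q) B"
    using assms by (intro emeasure_mono) auto
  finally show ?thesis .
qed

text \<open>By independence the probability is a product of factors
  \<open>1 - p e \<le> 1 - \<beta> \<le> exp (- \<beta>)\<close> over \<open>A\<close>.\<close>

lemma prob_none_selected_le:
  fixes \<beta> :: real
  assumes "finite E" "A \<subseteq> E" "\<And>e. e \<in> E \<Longrightarrow> \<beta> \<le> p e \<and> p e \<le> 1" "0 \<le> \<beta>"
  shows "measure_pmf.prob (Pi_pmf E False (\<lambda>e. bernoulli_pmf (p e))) {S. \<forall>e\<in>A. \<not> S e}
    \<le> exp (- \<beta> * card A)"
proof -
  let ?B = "\<lambda>e. if e \<in> A then {False} else UNIV"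
  have p: "0 \<le> p e" "p e \<le> 1" "\<beta> \<le> p e" if "e \<in> E" for e
    using assms(3)[OF that] assms(4) by auto
  have "{S. \<forall>e\<in>A. \<not> S e} = Pi E ?B"
    using assms(2) by (auto simp: Pi_iff split: if_splits)
  then have "measure_pmf.prob (Pi_pmf E False (\<lambda>e. bernoulli_pmf (p e))) {S. \<forall>e\<in>A. \<not> S e}
      = (\<Prod>e\<in>E. measure_pmf.prob (bernoulli_pmf (p e)) (?B e))"
    using assms(1) by (simp add: measure_Pi_pmf_Pi)
  also have "\<dots> \<le> (\<Prod>e\<in>E. if e \<in> A then exp (- \<beta>) else 1)"
  proof (intro prod_mono conjI)
    fix e assume "e \<in> E"
    then show "measure_pmf.prob (bernoulli_pmf (p e)) (?B e) \<le> (if e \<in> A then exp (- \<beta>) else 1)"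
      using p[of e] exp_ge_add_one_self[of "- \<beta>"] by (auto simp: measure_pmf_single)
  qed auto
  also have "\<dots> = (\<Prod>e\<in>A. exp (- \<beta>))"
    using assms(1,2) by (simp add: prod.If_cases Int_absorb1)
  also have "\<dots> = exp (- \<beta> * card A)"
    by (simp add: mult.commute flip: exp_of_nat_mult)
  finally show ?thesis .
qed

text \<open>Failure of the desired event at one walk. A walk that never stops, \<open>None\<close>,
  counts as a miss.\<close>

definition missed :: "('v, 'e) mgraph \<Rightarrow> 'v set \<Rightarrow> 'v \<Rightarrow> ('v, 'e) walk option \<Rightarrow> bool" where
  "missed G T v r \<longleftrightarrow> component G v \<inter> T \<noteq> {} \<and> \<not> (\<exists>w. r = Some w \<and> walk_end w \<in> T)"

text \<open>Fubini for independent draws: both sides are the probability of \<open>Q x y\<close>,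
  and the two binds commute.\<close>

lemma nn_integral_emeasure_swap:
  fixes p :: "'c pmf" and q :: "'d pmf"
  shows "(\<integral>\<^sup>+x. emeasure (measure_pmf q) {y. Q x y} \<partial>measure_pmf p) =
    (\<integral>\<^sup>+y. emeasure (measure_pmf p) {x. Q x y} \<partial>measure_pmf q)"
proof -
  have ind: "(\<lambda>z. indicator {True} (P z)) = indicator {z. P z}" for P :: "'c \<Rightarrow> bool"
    by (auto split: split_indicator)
  have ind': "(\<lambda>z. indicator {True} (P z)) = indicator {z. P z}" for P :: "'d \<Rightarrow> bool"
    by (auto split: split_indicator)
  have "emeasure (bind_pmf p (\<lambda>x. bind_pmf q (\<lambda>y. return_pmf (Q x y)))) {True} =
      emeasure (bind_pmf q (\<lambda>y. bind_pmf p (\<lambda>x. return_pmf (Q x y)))) {True}"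
    by (subst bind_commute_pmf) simp
  then show ?thesis by (simp add: ind ind')
qed

text \<open>
  A missing walk never meets the terminals, so it is also a run with no terminals at all, whose law
  does not depend on the selected edges; conditioning on it leaves those edges random.
\<close>

lemma prob_missed_le:
  fixes \<beta> l :: real
  assumes G: "multigraph G" and v: "v \<in> verts G"
    and p: "\<And>e. e \<in> edges G \<Longrightarrow> \<beta> \<le> p e \<and> p e \<le> 1" and \<beta>: "0 \<le> \<beta>"
  shows "(\<integral>\<^sup>+S. emeasure (measure_pmf (run_walk G (terminals G S) l (v, [])))
      {r. missed G (terminals G S) v r} \<partial>Pi_pmf (edges G) False (\<lambda>e. bernoulli_pmf (p e)))
    \<le> ennreal (exp (- \<beta> * (l + card (incident G v)) / 2))"
    (is "(\<integral>\<^sup>+S. ?miss S \<partial>_) \<le> ennreal ?b")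
proof -
  let ?P = "Pi_pmf (edges G) False (\<lambda>e. bernoulli_pmf (p e))"
  let ?R = "run_walk G {} l (v, [])"
  \<comment> \<open>\<open>Q\<close> keeps the consequences of a miss that can be tested on a
    selection and a run drawn independently of it.\<close>
  define Q where "Q S r \<longleftrightarrow> (\<exists>w. r = Some w \<and> l \<le> card (walk_edges w) \<and> walk_edges w \<subseteq> edges G \<and>
    (\<forall>e\<in>walk_edges w \<union> incident G v. \<not> S e))" for S and r :: "('a, 'b) walk option"
  have "?miss S \<le> emeasure (measure_pmf ?R) {r. Q S r}" for S
  proof (rule emeasure_pmf_le)
    fix r assume r: "r \<in> {r. missed G (terminals G S) v r}"
      "r \<in> set_pmf (run_walk G (terminals G S) l (v, []))"
    have "r \<noteq> None"
      using run_walk_lossless[OF G v walk_within_start, of "terminals G S" l] r(2)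
      by (metis pmf_eq_0_set_pmf)
    then obtain w where w: "r = Some w" by blast
    then have "w \<in> set_spmf (run_walk G (terminals G S) l (v, []))"
      using r(2) by (simp add: in_set_spmf)
    moreover have "component G v \<inter> terminals G S \<noteq> {}" "walk_end w \<notin> terminals G S"
      using r(1) w unfolding missed_def by blast+
    ultimately show "r \<in> {r. Q S r} \<and> pmf (run_walk G (terminals G S) l (v, [])) r \<le> pmf ?R r"
      using run_walk_avoiding_terminals[OF G, of w S l v]
        spmf_run_walk_mono[of "{}" "terminals G S" w G l "(v, [])"] by (simp add: Q_def w del: split_paired_Ex)
  qed
  then have "(\<integral>\<^sup>+S. ?miss S \<partial>?P) \<le> (\<integral>\<^sup>+S. emeasure (measure_pmf ?R) {r. Q S r} \<partial>?P)"
    by (intro nn_integral_mono)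
  also have "\<dots> = (\<integral>\<^sup>+r. emeasure (measure_pmf ?P) {S. Q S r} \<partial>?R)"
    by (rule nn_integral_emeasure_swap)
  also have "\<dots> \<le> (\<integral>\<^sup>+r. ennreal ?b \<partial>?R)"
  proof (intro nn_integral_mono)
    fix r
    show "emeasure (measure_pmf ?P) {S. Q S r} \<le> ennreal ?b"
    proof (cases "\<exists>w. r = Some w \<and> l \<le> card (walk_edges w) \<and> walk_edges w \<subseteq> edges G")
      case False
      then have "{S. Q S r} = {}" by (auto simp: Q_def)
      then show ?thesis by simp
    next
      case True
      then obtain w where w: "r = Some w" "l \<le> card (walk_edges w)" "walk_edges w \<subseteq> edges G" by blast
      let ?A = "walk_edges w \<union> incident G v"
      have fin: "finite (edges G)" using G by (simp add: multigraph_def)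
      have A: "?A \<subseteq> edges G" using w by (auto simp: incident_def)
      then have "finite ?A" using fin finite_subset by blast
      then have "card (walk_edges w) \<le> card ?A" "card (incident G v) \<le> card ?A"
        by (auto intro: card_mono)
      \<comment> \<open>Averaging the two lower bounds on \<open>card ?A\<close> keeps both gains in
        one exponent, at the price of the factor 1/2.\<close>
      then have "l + card (incident G v) \<le> 2 * card ?A" using w(2) by simp
      then have "\<beta> * (l + card (incident G v)) \<le> \<beta> * (2 * card ?A)"
        using \<beta> by (rule mult_left_mono)
      then have "exp (- \<beta> * card ?A) \<le> ?b" by simp
      moreover have "measure_pmf.prob ?P {S. \<forall>e\<in>?A. \<not> S e} \<le> exp (- \<beta> * card ?A)"
        using fin A p \<beta> by (rule prob_none_selected_le)
      moreover have "{S. Q S r} \<subseteq> {S. \<forall>e\<in>?A. \<not> S e}" using w by (auto simp: Q_def)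
      then have "measure_pmf.prob ?P {S. Q S r} \<le> measure_pmf.prob ?P {S. \<forall>e\<in>?A. \<not> S e}"
        by (rule measure_pmf.finite_measure_mono) simp
      ultimately have "measure_pmf.prob ?P {S. Q S r} \<le> ?b" by linarith
      then show ?thesis by (simp add: measure_pmf.emeasure_eq_measure)
    qed
  qed
  also have "\<dots> = ennreal ?b" by simp
  finally show ?thesis .
qed

section \<open>Union bound over all walks\<close>

text \<open>Regroups the walks by starting vertex. An edge starts walks once per distinct end, so a
  loop counts once, as in \<open>card (incident G v)\<close>.\<close>

lemma walk_index_eq_image:
  assumes "multigraph G"
  shows "walk_index G \<rho> = (\<lambda>(v, e, i). (e, v, i)) ` (SIGMA v:verts G. incident G v \<times> {..<\<rho>})"
  using assms by (force simp: walk_index_def multigraph_def incident_def)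

lemma finite_walk_index: "multigraph G \<Longrightarrow> finite (walk_index G \<rho>)"
  by (subst walk_index_eq_image) (auto simp: multigraph_def incident_def)

lemma sum_walk_index:
  fixes f :: "'v \<Rightarrow> real"
  assumes "multigraph G"
  shows "(\<Sum>(e, v, i)\<in>walk_index G \<rho>. f v) = \<rho> * (\<Sum>v\<in>verts G. card (incident G v) * f v)"
proof -
  have "(\<Sum>(e, v, i)\<in>walk_index G \<rho>. f v) = (\<Sum>(v, e, i)\<in>(SIGMA v:verts G. incident G v \<times> {..<\<rho>}). f v)"
    unfolding walk_index_eq_image[OF assms]
    by (subst sum.reindex) (auto simp: inj_on_def intro!: sum.cong)
  also have "\<dots> = (\<Sum>v\<in>verts G. \<Sum>(e, i)\<in>incident G v \<times> {..<\<rho>}. f v)"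
    using assms by (subst sum.Sigma) (auto simp: finite_incident multigraph_def split_beta)
  also have "\<dots> = (\<Sum>v\<in>verts G. \<rho> * (card (incident G v) * f v))"
    by (simp add: split_beta card_cartesian_product mult_ac)
  finally show ?thesis by (simp add: sum_distrib_left)
qed

text \<open>Given the selection, the union bound reduces the collection to the marginal law of each
  walk; \<open>prob_missed_le\<close> then averages over the selection.\<close>

lemma prob_shorted_walks_miss_le:
  fixes \<beta> l :: real
  assumes G: "multigraph G"
    and p: "\<And>e. e \<in> edges G \<Longrightarrow> \<beta> \<le> p e \<and> p e \<le> 1" and \<beta>: "0 \<le> \<beta>"
  shows "measure_pmf.prob (shorted_walks G p l \<rho>) {(T, W). \<exists>(e, v, i)\<in>walk_index G \<rho>. missed G T v (W (e, v, i))}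
    \<le> \<rho> * (\<Sum>v\<in>verts G. card (incident G v) * exp (- \<beta> * (l + card (incident G v)) / 2))"
proof -
  let ?I = "walk_index G \<rho>"
  let ?P = "Pi_pmf (edges G) False (\<lambda>e. bernoulli_pmf (p e))"
  let ?run = "\<lambda>S (e, v, i). run_walk G (terminals G S) l (v, [])"
  let ?M = "\<lambda>S. Pi_pmf ?I None (?run S)"
  let ?b = "\<lambda>v. exp (- \<beta> * (l + card (incident G v)) / 2)"
  let ?miss = "\<lambda>S (e, v, i). {r. missed G (terminals G S) v r}"
  have fin: "finite ?I" using G by (rule finite_walk_index)
  have "emeasure (shorted_walks G p l \<rho>) {(T, W). \<exists>(e, v, i)\<in>?I. missed G T v (W (e, v, i))}
      = (\<integral>\<^sup>+S. emeasure (?M S) (\<Union>j\<in>?I. {W. W j \<in> ?miss S j}) \<partial>?P)"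
    unfolding shorted_walks_def map_pmf_def[symmetric] emeasure_bind_pmf
    by (intro nn_integral_cong) (auto simp: emeasure_map_pmf intro!: arg_cong[where f="emeasure _"])
  also have "\<dots> \<le> (\<integral>\<^sup>+S. (\<Sum>j\<in>?I. emeasure (?M S) {W. W j \<in> ?miss S j}) \<partial>?P)"
    using fin by (intro nn_integral_mono emeasure_subadditive_finite) auto
  also have "\<dots> = (\<integral>\<^sup>+S. (\<Sum>j\<in>?I. emeasure (?run S j) (?miss S j)) \<partial>?P)"
  proof (intro nn_integral_cong sum.cong refl)
    fix S j assume j: "j \<in> ?I"
    have "emeasure (?M S) {W. W j \<in> ?miss S j} = emeasure (map_pmf (\<lambda>W. W j) (?M S)) (?miss S j)"
      by (simp add: emeasure_map_pmf vimage_def)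
    then show "emeasure (?M S) {W. W j \<in> ?miss S j} = emeasure (?run S j) (?miss S j)"
      using j fin by (simp add: Pi_pmf_component)
  qed
  also have "\<dots> = (\<Sum>j\<in>?I. \<integral>\<^sup>+S. emeasure (?run S j) (?miss S j) \<partial>?P)"
    by (rule nn_integral_sum) simp
  also have "\<dots> \<le> (\<Sum>j\<in>?I. ennreal (case j of (e, v, i) \<Rightarrow> ?b v))"
  proof (rule sum_mono)
    fix j assume "j \<in> ?I"
    obtain e v i where "j = (e, v, i)" by (cases j)
    moreover from this have "v \<in> verts G"
      using G \<open>j \<in> ?I\<close> by (auto simp: walk_index_def multigraph_def)
    ultimately show "(\<integral>\<^sup>+S. emeasure (?run S j) (?miss S j) \<partial>?P) \<le> ennreal (case j of (e, v, i) \<Rightarrow> ?b v)"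
      using prob_missed_le[OF G _ p \<beta>, where v = v and l = l] by simp
  qed
  also have "\<dots> = ennreal (\<Sum>(e, v, i)\<in>?I. ?b v)"
    by (rule sum_ennreal) auto
  also have "(\<Sum>(e, v, i)\<in>?I. ?b v) = \<rho> * (\<Sum>v\<in>verts G. card (incident G v) * ?b v)"
    using G by (rule sum_walk_index)
  finally show ?thesis
    by (simp add: measure_pmf.emeasure_eq_measure sum_nonneg)
qed

section \<open>Numerical estimate of the union bound\<close>

text \<open>This is \<open>y \<le> exp y\<close> at \<open>y = \<beta> * x / 2\<close>.\<close>

lemma mult_exp_neg_le:
  fixes \<beta> x :: real
  assumes "0 < \<beta>"
  shows "x * exp (- \<beta> * x / 2) \<le> 2 / \<beta>"
proof -
  have "\<beta> * x / 2 \<le> exp (\<beta> * x / 2)" using exp_ge_add_one_self[of "\<beta> * x / 2"] by linarith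
  then have "\<beta> * x / 2 * exp (- (\<beta> * x / 2)) \<le> exp (\<beta> * x / 2) * exp (- (\<beta> * x / 2))"
    by (rule mult_right_mono) simp
  then have "\<beta> * x / 2 * exp (- \<beta> * x / 2) \<le> 1" by (simp flip: exp_add)
  then show ?thesis using assms by (simp add: field_simps)
qed

lemma miss_bound_le_powr:
  fixes c a K \<beta> \<epsilon> l :: real
  assumes pos: "c > 0" "a > 0" "K > 0" "0 < \<beta>" "0 < \<epsilon>"
    and n: "2 \<le> n" "card V = n"
    and few: "(\<forall>v\<in>V. real (d v) \<le> real n powr a) \<or> 1 / \<beta> \<le> real n powr a"
    and \<epsilon>: "1 / \<epsilon> \<le> real n powr a"
    and \<rho>: "real \<rho> \<le> K * ln n / \<epsilon>\<^sup>2"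
    and l: "2 * (2 + 3 * a + 4 * K + c) * ln n / \<beta> \<le> l"
  shows "\<rho> * (\<Sum>v\<in>V. d v * exp (- \<beta> * (l + d v) / 2)) \<le> real n powr (- c)"
proof -
  \<comment> \<open>The budget of powers of \<open>n\<close>: 2 for the number of vertices and for
    \<open>ln n \<le> n\<close>, \<open>2 * a\<close> for the inverse square of \<epsilon>,
    \<open>a\<close> for the degree factor, \<open>4 * K\<close> for the constant
    \<open>2 * K\<close>, and \<open>c\<close> for the target. The extra factor 2 in the bound on
    \<open>l\<close> offsets the halved exponent.\<close>
  define C where "C = 2 + 3 * a + 4 * K + c"
  have "\<beta> * l / 2 \<ge> C * ln n" using l pos by (simp add: C_def field_simps)
  then have "exp (- \<beta> * l / 2) \<le> exp (- C * ln n)"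
    by (subst exp_le_cancel_iff) linarith
  also have "\<dots> = real n powr (- C)" using n by (simp add: powr_def)
  finally have decay: "exp (- \<beta> * l / 2) \<le> real n powr (- C)" .
  have summand: "d v * exp (- \<beta> * (l + d v) / 2) \<le> 2 * real n powr a * real n powr (- C)"
    if "v \<in> V" for v
  proof -
    \<comment> \<open>If degrees are polynomial, the exponential is bounded by 1; if
      \<open>1 / \<beta>\<close> is, the exponential absorbs the degree.\<close>
    have degree: "d v * exp (- \<beta> * d v / 2) \<le> 2 * real n powr a"
      using few
    proof
      assume "\<forall>v\<in>V. real (d v) \<le> real n powr a"
      moreover have "d v * exp (- \<beta> * d v / 2) \<le> real (d v) * 1"
        using pos by (intro mult_left_mono) auto
      ultimately show ?thesis using that powr_ge_zero[of n a] by fastforce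
    next
      assume "1 / \<beta> \<le> real n powr a"
      then show ?thesis using mult_exp_neg_le[OF pos(4), of "d v"] by simp
    qed
    have "- \<beta> * (l + d v) / 2 = - \<beta> * d v / 2 + - \<beta> * l / 2"
      by (simp add: field_simps)
    then have "d v * exp (- \<beta> * (l + d v) / 2) = d v * exp (- \<beta> * d v / 2) * exp (- \<beta> * l / 2)"
      by (simp only: exp_add mult.assoc)
    also have "\<dots> \<le> 2 * real n powr a * real n powr (- C)"
      using degree decay by (rule mult_mono) auto
    finally show ?thesis .
  qed
  have "(1 / \<epsilon>)\<^sup>2 \<le> (real n powr a)\<^sup>2" using \<epsilon> pos by (intro power_mono) auto
  also have "\<dots> = real n powr (2 * a)" using n by (simp add: powr_power mult.commute)
  finally have \<epsilon>2: "1 / \<epsilon>\<^sup>2 \<le> real n powr (2 * a)" by (simp add: power_one_over)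
  have "real \<rho> \<le> K * ln n * (1 / \<epsilon>\<^sup>2)" using \<rho> by simp
  also have "\<dots> \<le> K * n * real n powr (2 * a)"
    using \<epsilon>2 pos n ln_le_minus_one[of n] by (intro mult_mono) auto
  finally have \<rho>_le: "real \<rho> \<le> K * n * real n powr (2 * a)" .
  \<comment> \<open>From \<open>n \<ge> 2\<close> alone, \<open>2 * K \<le> 4 * K * ln n\<close>, so
    the constant is absorbed into a power of \<open>n\<close> without requiring \<open>n\<close> to
    be large.\<close>
  have "1 \<le> 2 * ln (real n)"
  proof -
    have "ln 2 \<le> ln (real n)" using n by simp
    then show ?thesis using ln2_ge_two_thirds by simp
  qed
  then have "2 * K * 1 \<le> 2 * K * (2 * ln n)" using pos by (intro mult_left_mono) auto
  then have "2 * K \<le> exp (4 * K * ln n)"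
    using exp_ge_add_one_self[of "4 * K * ln n"] by linarith
  also have "\<dots> = real n powr (4 * K)" using n by (simp add: powr_def)
  finally have K_le: "2 * K \<le> real n powr (4 * K)" .
  have "\<rho> * (\<Sum>v\<in>V. d v * exp (- \<beta> * (l + d v) / 2))
    \<le> (K * n * real n powr (2 * a)) * (n * (2 * real n powr a * real n powr (- C)))"
  proof (rule mult_mono[OF \<rho>_le])
    show "(\<Sum>v\<in>V. d v * exp (- \<beta> * (l + d v) / 2)) \<le> n * (2 * real n powr a * real n powr (- C))"
      using sum_bounded_above[where A = V, OF summand] n(2) by simp
  qed (use pos in \<open>auto intro!: sum_nonneg\<close>)
  also have "\<dots> = 2 * K * (real n powr 2 * (real n powr (2 * a) * (real n powr a * real n powr (- C))))"
    using n by (simp add: power2_eq_square)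
  also have "\<dots> \<le> real n powr (4 * K) * (real n powr 2 * (real n powr (2 * a) * (real n powr a * real n powr (- C))))"
    using K_le by (rule mult_right_mono) simp
  also have "\<dots> = real n powr (- c)"
    by (simp only: powr_add[symmetric]) (simp add: C_def algebra_simps)
  finally show ?thesis .
qed

text \<open>In a multigraph the number of walks is not controlled by the number of vertices, because
  of parallel edges and small \<epsilon>. The polynomial bounds with exponent \<open>a\<close> make
  the union bound affordable.\<close>

theorem theorem4p3:
  fixes c a K :: real
  assumes "c > 0" and "a > 0" and "K > 0"
  shows "\<exists>C>0. \<forall>(G :: ('v, 'e) mgraph) \<beta> \<epsilon> \<rho> D.
    multigraph G \<longrightarrow> 0 < \<beta> \<longrightarrow> \<beta> < 1 \<longrightarrow> 0 < \<epsilon> \<longrightarrow>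
    real (card (edges G)) \<le> real (card (verts G)) powr a \<or>
      1 / \<beta> \<le> real (card (verts G)) powr a \<longrightarrow>
    1 / \<epsilon> \<le> real (card (verts G)) powr a \<longrightarrow>
    beta_shorted C K \<beta> \<epsilon> G \<rho> D \<longrightarrow>
    measure_pmf.prob D
      {(T, W). \<forall>(e, v, i)\<in>walk_index G \<rho>. component G v \<inter> T \<noteq> {} \<longrightarrow>
         (\<exists>w. W (e, v, i) = Some w \<and> walk_end w \<in> T)}
      \<ge> 1 - real (card (verts G)) powr (- c)"
proof (intro exI conjI allI impI)
  show "0 < 2 * (2 + 3 * a + 4 * K + c)" using assms by simp
next
  fix G :: "('v, 'e) mgraph" and \<beta> \<epsilon> \<rho> D
  assume G: "multigraph G" and \<beta>: "0 < \<beta>" "\<beta> < 1" and \<epsilon>: "0 < \<epsilon>"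
    and few: "real (card (edges G)) \<le> real (card (verts G)) powr a \<or>
      1 / \<beta> \<le> real (card (verts G)) powr a"
    and \<epsilon>n: "1 / \<epsilon> \<le> real (card (verts G)) powr a"
    and D: "beta_shorted (2 * (2 + 3 * a + 4 * K + c)) K \<beta> \<epsilon> G \<rho> D"
  define n where "n = card (verts G)"
  let ?hit = "{(T, W). \<forall>(e, v, i)\<in>walk_index G \<rho>. component G v \<inter> T \<noteq> {} \<longrightarrow>
         (\<exists>w. W (e, v, i) = Some w \<and> walk_end w \<in> T)}"
  let ?miss = "{(T, W). \<exists>(e, v, i)\<in>walk_index G \<rho>. missed G T v (W (e, v, i))}"
  have "?hit = - ?miss" by (simp add: missed_def set_eq_iff split_beta del: split_paired_All split_paired_Ex) blast
  then have hit: "measure_pmf.prob D ?hit = 1 - measure_pmf.prob D ?miss"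
    using measure_pmf.prob_compl[of ?miss D] by (simp add: Compl_eq_Diff_UNIV)
  \<comment> \<open>For \<open>n = 0\<close> the target \<open>0 powr (- c)\<close> is 0, and there
    are no walks to miss; for \<open>n = 1\<close> the target is 1. The estimate needs
    \<open>n \<ge> 2\<close>, where \<open>ln n\<close> is bounded away from 0.\<close>
  consider "n = 0" | "n = 1" | "2 \<le> n" by linarith
  then have "measure_pmf.prob D ?miss \<le> real n powr (- c)"
  proof cases
    case 1
    then have "verts G = {}" using G by (simp add: n_def multigraph_def)
    then have "walk_index G \<rho> = {}" using walk_index_eq_image[OF G] by simp
    then show ?thesis by simp
  next
    case 2
    then show ?thesis by simp
  next
    case 3
    obtain p l where p: "\<And>e. e \<in> edges G \<Longrightarrow> \<beta> \<le> p e \<and> p e \<le> 1"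
      and l: "2 * (2 + 3 * a + 4 * K + c) * ln n / \<beta> \<le> l" and D_eq: "D = shorted_walks G p l \<rho>"
      and \<rho>: "real \<rho> \<le> K * ln n / \<epsilon>\<^sup>2"
      using D by (auto simp: beta_shorted_def n_def)
    have "card (incident G v) \<le> card (edges G)" for v
      using G by (intro card_mono) (auto simp: multigraph_def incident_def)
    then have "(\<forall>v\<in>verts G. real (card (incident G v)) \<le> real n powr a) \<or> 1 / \<beta> \<le> real n powr a"
      using few unfolding n_def by (meson of_nat_mono order_trans)
    then have "\<rho> * (\<Sum>v\<in>verts G. card (incident G v) * exp (- \<beta> * (l + card (incident G v)) / 2))
        \<le> real n powr (- c)"
      using \<epsilon>n 3 assms \<beta> \<epsilon> \<rho> l by (intro miss_bound_le_powr) (auto simp: n_def)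
    moreover have "measure_pmf.prob D ?miss
        \<le> \<rho> * (\<Sum>v\<in>verts G. card (incident G v) * exp (- \<beta> * (l + card (incident G v)) / 2))"
      unfolding D_eq using G p \<beta>(1)[THEN less_imp_le] by (rule prob_shorted_walks_miss_le)
    ultimately show ?thesis by linarith
  qed
  with hit show "1 - real (card (verts G)) powr (- c) \<le> measure_pmf.prob D ?hit"
    by (simp add: n_def)
qed

end
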